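(* Let $\Omega_2=\{v\in[1,\infty) : v=v(G) \text{ for some two-generated group } G\}$, where a two-generated group is a group $G$ together with a fixed generating set of two elements and $v(G)$ is its exponential growth rate with respect to that generating set. Then $\#\Omega_2=2^{\aleph_0}$.
   Context: For a group $G$ with a fixed finite set of generators, let $d$ be the word metric corresponding to this generating set (generators and their inverses have length $1$), let $B_G(n)=\{g\in G : d(g,e)\le n\}$, and define the (exponential) growth rate $v(G)=\lim_{n\to\infty}\sqrt[n]{\#B_G(n)}$ (the limit exists). *)

theory Defs
  imports "HOL-Analysis.Analysis" "HOL-Algebra.Generated_Groups" "HOL-Library.Equipollence"
begin

(* The infimum below is over a nonempty set as soon as S generates G. *)
definition word_length :: "('a, 'b) monoid_scheme \<Rightarrow> 'a set \<Rightarrow> 'a \<Rightarrow> nat" where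
  "word_length G S g =
     (LEAST n. \<exists>ws. length ws = n \<and> set ws \<subseteq> S \<union> m_inv G ` S \<and> foldr (mult G) ws (one G) = g)"

definition word_metric :: "('a, 'b) monoid_scheme \<Rightarrow> 'a set \<Rightarrow> 'a \<Rightarrow> 'a \<Rightarrow> nat" where
  "word_metric G S g h = word_length G S (inv\<^bsub>G\<^esub> g \<otimes>\<^bsub>G\<^esub> h)"

definition word_ball :: "('a, 'b) monoid_scheme \<Rightarrow> 'a set \<Rightarrow> nat \<Rightarrow> 'a set" where
  "word_ball G S n = {g \<in> carrier G. word_metric G S g \<one>\<^bsub>G\<^esub> \<le> n}"

definition growth_rate :: "('a, 'b) monoid_scheme \<Rightarrow> 'a set \<Rightarrow> real" where
  "growth_rate G S = lim (\<lambda>n. root n (real (card (word_ball G S n))))"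

definition two_generated :: "('a, 'b) monoid_scheme \<Rightarrow> 'a set \<Rightarrow> bool" where
  "two_generated G S \<longleftrightarrow> group G \<and> S \<subseteq> carrier G \<and> card S = 2 \<and> generate G S = carrier G"

(* A finitely generated group is countable, so up to isomorphism its carrier is a set of
   natural numbers.  growth_rate_in_Omega2 below shows that groups over any other
   type contribute no further values. *)
definition Omega2 :: "real set" where
  "Omega2 = {v. 1 \<le> v \<and> (\<exists>(G :: nat monoid) S. two_generated G S \<and> v = growth_rate G S)}"

definition represents :: "('a, 'b) monoid_scheme \<Rightarrow> 'a set \<Rightarrow> 'a list \<Rightarrow> 'a \<Rightarrow> bool" where
  "represents G S ws g \<longleftrightarrow> set ws \<subseteq> S \<union> m_inv G ` S \<and> foldr (mult G) ws (one G) = g"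

lemma word_length_alt: "word_length G S g = (LEAST n. \<exists>ws. length ws = n \<and> represents G S ws g)"
  by (simp add: word_length_def represents_def)

context group
begin

lemma represents_append:
  assumes S: "S \<subseteq> carrier G" and "represents G S us g" "represents G S ws h"
  shows "represents G S (us @ ws) (g \<otimes> h)" "g \<in> carrier G"
proof -
  have "represents G S (us @ ws) (g \<otimes> h) \<and> g \<in> carrier G" using assms(2)
  proof (induction us arbitrary: g)
    case Nil
    have "h \<in> carrier G" using assms(3)
    proof (induction ws arbitrary: h)
      case (Cons a ws)
      have "a \<in> carrier G" using Cons.prems S by (auto simp: represents_def)
      moreover have "foldr (\<otimes>) ws \<one> \<in> carrier G" using Cons by (auto simp: represents_def)
      ultimately show ?case using Cons.prems by (auto simp: represents_def)
    qed (auto simp: represents_def)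
    then show ?case using Nil assms(3) by (auto simp: represents_def)
  next
    case (Cons a us)
    define k where "k = foldr (\<otimes>) us \<one>"
    have a: "a \<in> carrier G" "a \<in> S \<union> m_inv G ` S" using Cons.prems S by (auto simp: represents_def)
    have g: "g = a \<otimes> k" using Cons.prems by (auto simp: represents_def k_def)
    have "represents G S us k" using Cons.prems by (auto simp: represents_def k_def)
    note IH = Cons.IH[OF this]
    have h: "h \<in> carrier G" using assms(3)
    proof (induction ws arbitrary: h)
      case (Cons a ws)
      have "a \<in> carrier G" using Cons.prems S by (auto simp: represents_def)
      moreover have "foldr (\<otimes>) ws \<one> \<in> carrier G" using Cons by (auto simp: represents_def)
      ultimately show ?case using Cons.prems by (auto simp: represents_def)
    qed (auto simp: represents_def)
    show ?case using IH a g h by (auto simp: represents_def m_assoc)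
  qed
  then show "represents G S (us @ ws) (g \<otimes> h)" "g \<in> carrier G" by auto
qed

lemma generate_represents:
  assumes S: "S \<subseteq> carrier G" and "g \<in> generate G S"
  shows "\<exists>ws. represents G S ws g"
  using assms(2)
proof induction
  case one
  have "represents G S [] \<one>" by (simp add: represents_def)
  then show ?case by blast
next
  case (incl h)
  then have "represents G S [h] h" using S by (auto simp: represents_def)
  then show ?case by blast
next
  case (inv h)
  then have "h \<in> carrier G" using S by auto
  then have "represents G S [inv h] (inv h)" using inv by (auto simp: represents_def)
  then show ?case by blast
next
  case (eng h1 h2)
  then show ?case using represents_append[OF S] by blast
qed

lemma represents_inv:
  assumes S: "S \<subseteq> carrier G" and "represents G S ws g"
  shows "\<exists>us. length us = length ws \<and> represents G S us (inv g)"
  using assms(2)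
proof (induction ws arbitrary: g)
  case Nil
  then show ?case by (auto simp: represents_def)
next
  case (Cons a ws)
  define k where "k = foldr (\<otimes>) ws \<one>"
  have a: "a \<in> carrier G" "a \<in> S \<union> m_inv G ` S" using Cons.prems S by (auto simp: represents_def)
  have g: "g = a \<otimes> k" using Cons.prems by (auto simp: represents_def k_def)
  have kr: "represents G S ws k" using Cons.prems by (auto simp: represents_def k_def)
  have kc: "k \<in> carrier G" using represents_append(2)[OF S kr kr] .
  obtain us where us: "length us = length ws" "represents G S us (inv k)" using Cons.IH[OF kr] by blast
  have "inv a \<in> S \<union> m_inv G ` S" using a S by auto
  then have "represents G S [inv a] (inv a)" using a by (auto simp: represents_def)
  then have "represents G S (us @ [inv a]) (inv k \<otimes> inv a)" using represents_append(1)[OF S us(2)] by blast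
  moreover have "inv k \<otimes> inv a = inv g" using g a kc inv_mult_group by simp
  ultimately show ?case using us(1) by (intro exI[of _ "us @ [inv a]"]) auto
qed

lemma word_ball_iff:
  assumes S: "S \<subseteq> carrier G" and gen: "generate G S = carrier G"
  shows "g \<in> word_ball G S n \<longleftrightarrow> (\<exists>ws. length ws \<le> n \<and> represents G S ws g)"
proof
  assume "g \<in> word_ball G S n"
  then have g: "g \<in> carrier G" and le: "word_length G S (inv g) \<le> n"
    by (auto simp: word_ball_def word_metric_def)
  have "\<exists>n ws. length ws = n \<and> represents G S ws (inv g)"
    using generate_represents[OF S] gen g by auto
  from LeastI_ex[OF this] obtain ws where ws: "length ws = word_length G S (inv g)" "represents G S ws (inv g)"
    unfolding word_length_alt by blast
  show "\<exists>ws. length ws \<le> n \<and> represents G S ws g"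
    using represents_inv[OF S ws(2)] ws(1) le g inv_inv[OF g] by metis
next
  assume "\<exists>ws. length ws \<le> n \<and> represents G S ws g"
  then obtain ws where ws: "length ws \<le> n" "represents G S ws g" by blast
  have g: "g \<in> carrier G" using represents_append(2)[OF S ws(2) ws(2)] .
  obtain us where us: "length us = length ws" "represents G S us (inv g)"
    using represents_inv[OF S ws(2)] by blast
  then have "word_length G S (inv g) \<le> length ws" unfolding word_length_alt by (intro Least_le) auto
  then show "g \<in> word_ball G S n" using g ws by (auto simp: word_ball_def word_metric_def)
qed

lemma finite_word_ball:
  assumes S: "S \<subseteq> carrier G" "finite S" and gen: "generate G S = carrier G"
  shows "finite (word_ball G S n)"
proof -
  have "word_ball G S n \<subseteq>
    (\<lambda>ws. foldr (\<otimes>) ws \<one>) ` {ws. set ws \<subseteq> S \<union> m_inv G ` S \<and> length ws \<le> n}"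
    using word_ball_iff[OF S(1) gen] by (auto simp: represents_def)
  moreover have "finite {ws. set ws \<subseteq> S \<union> m_inv G ` S \<and> length ws \<le> n}"
    using S(2) by (intro finite_lists_length_le) auto
  ultimately show ?thesis by (meson finite_imageI finite_subset)
qed

lemma card_word_ball_pos:
  assumes S: "S \<subseteq> carrier G" "finite S" and gen: "generate G S = carrier G"
  shows "1 \<le> card (word_ball G S n)"
proof -
  have "represents G S [] \<one>" by (simp add: represents_def)
  then have "\<one> \<in> word_ball G S n" using word_ball_iff[OF S(1) gen] by fastforce
  then show ?thesis using finite_word_ball[OF assms, of n] by (auto simp: Suc_le_eq card_gt_0_iff)
qed

lemma card_word_ball_add:
  assumes S: "S \<subseteq> carrier G" "finite S" and gen: "generate G S = carrier G"
  shows "card (word_ball G S (m + n)) \<le> card (word_ball G S m) * card (word_ball G S n)"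
proof -
  have "word_ball G S (m + n) \<subseteq> (\<lambda>(x, y). x \<otimes> y) ` (word_ball G S m \<times> word_ball G S n)"
  proof
    fix g assume "g \<in> word_ball G S (m + n)"
    then obtain ws where ws: "length ws \<le> m + n" "represents G S ws g"
      using word_ball_iff[OF S(1) gen] by blast
    define us vs where "us = take m ws" and "vs = drop m ws"
    have sub: "set us \<subseteq> set ws" "set vs \<subseteq> set ws" unfolding us_def vs_def
      by (auto dest: in_set_takeD in_set_dropD)
    have u: "represents G S us (foldr (\<otimes>) us \<one>)" and v: "represents G S vs (foldr (\<otimes>) vs \<one>)"
      using ws(2) sub by (auto simp: represents_def)
    have "us @ vs = ws" by (simp add: us_def vs_def)
    with represents_append(1)[OF S(1) u v] ws(2)
    have "g = foldr (\<otimes>) us \<one> \<otimes> foldr (\<otimes>) vs \<one>" by (simp add: represents_def)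
    moreover have "length us \<le> m" "length vs \<le> n" using ws(1) by (auto simp: us_def vs_def)
    then have "foldr (\<otimes>) us \<one> \<in> word_ball G S m" "foldr (\<otimes>) vs \<one> \<in> word_ball G S n"
      using u v word_ball_iff[OF S(1) gen] by blast+
    ultimately show "g \<in> (\<lambda>(x, y). x \<otimes> y) ` (word_ball G S m \<times> word_ball G S n)" by force
  qed
  then have "card (word_ball G S (m + n)) \<le> card (word_ball G S m \<times> word_ball G S n)"
    using finite_word_ball[OF assms] by (meson card_image_le card_mono finite_SigmaI finite_imageI le_trans)
  then show ?thesis by (simp add: card_cartesian_product)
qed

end

lemma subadditive_converges:
  fixes a :: "nat \<Rightarrow> real"
  assumes nonneg: "\<And>n. 0 \<le> a n" and sub: "\<And>m n. a (m + n) \<le> a m + a n"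
  shows "convergent (\<lambda>n. a n / real n)"
proof -
  define L where "L = (INF n\<in>{1..}. a n / real n)"
  have bdd: "bdd_below ((\<lambda>n. a n / real n) ` {1..})"
    by (rule bdd_belowI[of _ 0]) (auto simp: nonneg)
  have L_le: "L \<le> a n / real n" if "1 \<le> n" for n
    unfolding L_def by (rule cINF_lower[OF bdd]) (use that in auto)
  have mult: "a (q * k + r) \<le> real q * a k + a r" for q k r
  proof (induction q)
    case (Suc q)
    have "a (Suc q * k + r) \<le> a k + a (q * k + r)" using sub[of k "q * k + r"] by (simp add: add.assoc)
    with Suc show ?case by (simp add: algebra_simps)
  qed simp
  have "(\<lambda>n. a n / real n) \<longlonglongrightarrow> L"
  proof (rule LIMSEQ_I)
    fix e :: real assume e: "0 < e"
    have "\<exists>k\<in>{1..}. a k / real k < L + e / 2"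
      using cINF_less_iff[OF _ bdd, of "L + e / 2"] e unfolding L_def[symmetric] by auto
    then obtain k where k: "1 \<le> k" "a k / real k < L + e / 2" by auto
    define M where "M = Max (a ` {..<k})"
    have M: "a r \<le> M" if "r < k" for r unfolding M_def using that by (intro Max_ge) auto
    obtain N where N: "2 * M / e < real N" using reals_Archimedean2 by blast
    show "\<exists>N. \<forall>n\<ge>N. norm (a n / real n - L) < e"
    proof (intro exI[of _ "Suc N"] allI impI)
      fix n assume n: "Suc N \<le> n"
      then have n0: "real n > 0" by simp
      have "a n \<le> real (n div k) * a k + a (n mod k)"
        using mult[of "n div k" k "n mod k"] by simp
      also have "real (n div k) * a k \<le> real n / real k * a k"
        by (intro mult_right_mono nonneg of_nat_div_le_of_nat)
      also have "a (n mod k) \<le> M" using k by (intro M) simp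
      finally have "a n \<le> real n * (a k / real k) + M" by (simp add: field_simps)
      then have "a n / real n \<le> a k / real k + M / real n" using n0 by (simp add: field_simps)
      moreover have "M / real n < e / 2"
      proof -
        have "2 * M / e < real n" using N n by linarith
        then show ?thesis using e n0 by (simp add: field_simps)
      qed
      ultimately have "a n / real n < L + e" using k(2) by linarith
      moreover have "L \<le> a n / real n" using n by (intro L_le) simp
      ultimately show "norm (a n / real n - L) < e" using e by simp
    qed
  qed
  then show ?thesis by (auto simp: convergent_def)
qed

theorem growth_rate_LIMSEQ:
  assumes G: "group G" and S: "S \<subseteq> carrier G" "finite S" and gen: "generate G S = carrier G"
  shows "(\<lambda>n. root n (real (card (word_ball G S n)))) \<longlonglongrightarrow> growth_rate G S"
    and "1 \<le> growth_rate G S"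
proof -
  define a where "a n = ln (real (card (word_ball G S n)))" for n
  have pos: "1 \<le> card (word_ball G S n)" for n using group.card_word_ball_pos[OF G S gen] .
  have pos': "0 < card (word_ball G S n)" for n using pos[of n] by linarith
  have "a (m + n) \<le> a m + a n" for m n
  proof -
    have "real (card (word_ball G S (m + n))) \<le> real (card (word_ball G S m) * card (word_ball G S n))"
      using group.card_word_ball_add[OF G S gen] by (simp only: of_nat_le_iff)
    then have "a (m + n) \<le> ln (real (card (word_ball G S m)) * real (card (word_ball G S n)))"
      unfolding a_def using pos' by (subst ln_le_cancel_iff) auto
    then show ?thesis using pos'[of m] pos'[of n] by (simp add: a_def ln_mult)
  qed
  moreover have "0 \<le> a n" for n using pos[of n] by (simp add: a_def)
  ultimately have "convergent (\<lambda>n. a n / real n)" by (intro subadditive_converges)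
  then obtain l where "(\<lambda>n. a n / real n) \<longlonglongrightarrow> l" by (auto simp: convergent_def)
  then have "(\<lambda>n. exp (a n / real n)) \<longlonglongrightarrow> exp l" by (intro tendsto_exp)
  moreover have "\<forall>\<^sub>F n in sequentially. exp (a n / real n) = root n (real (card (word_ball G S n)))"
  proof (rule eventually_sequentiallyI[of 1])
    fix n :: nat assume "1 \<le> n"
    then show "exp (a n / real n) = root n (real (card (word_ball G S n)))"
      using pos'[of n] by (simp add: root_powr_inverse powr_def a_def)
  qed
  ultimately have lim: "(\<lambda>n. root n (real (card (word_ball G S n)))) \<longlonglongrightarrow> exp l"
    by (rule Lim_transform_eventually)
  then have eq: "growth_rate G S = exp l" unfolding growth_rate_def by (rule limI)
  with lim show "(\<lambda>n. root n (real (card (word_ball G S n)))) \<longlonglongrightarrow> growth_rate G S" by simp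
  moreover have "1 \<le> root n (real (card (word_ball G S n)))" if "1 \<le> n" for n
    using that pos[of n] by simp
  ultimately show "1 \<le> growth_rate G S" by (intro LIMSEQ_le_const) blast+
qed

lemma word_ball_iso:
  assumes G: "group G" and H: "group H" and S: "S \<subseteq> carrier G" and gen: "generate G S = carrier G"
    and f: "f \<in> iso G H"
  shows "generate H (f ` S) = carrier H"
    and "word_ball H (f ` S) n = f ` word_ball G S n"
proof -
  have fh: "group_hom G H f"
    using G H f by (simp add: group_hom_def group_hom_axioms_def iso_def)
  then show gH: "generate H (f ` S) = carrier H"
    using group_hom.generate_img[OF fh S] gen f by (simp add: iso_def bij_betw_def)
  have SH: "f ` S \<subseteq> carrier H" using f S by (auto simp: iso_def bij_betw_def)
  have inv: "m_inv H ` f ` S = f ` m_inv G ` S"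
    unfolding image_image by (rule image_cong) (use S group_hom.hom_inv[OF fh] in auto)
  have word: "foldr (mult H) (map f ws) (one H) = f (foldr (mult G) ws (one G)) \<and> foldr (mult G) ws (one G) \<in> carrier G"
    if "set ws \<subseteq> S \<union> m_inv G ` S" for ws
    using that
  proof (induction ws)
    case Nil
    then show ?case using group_hom.hom_one[OF fh] G by (simp add: group.is_monoid)
  next
    case (Cons x ws)
    then have "x \<in> carrier G" using S G by auto
    with Cons G show ?case using group_hom.hom_mult[OF fh] by (simp add: group.is_monoid monoid.m_closed)
  qed
  show "word_ball H (f ` S) n = f ` word_ball G S n"
  proof (intro equalityI subsetI)
    fix h assume "h \<in> word_ball H (f ` S) n"
    then obtain us where us: "length us \<le> n" "represents H (f ` S) us h"
      using group.word_ball_iff[OF H SH gH] by blast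
    then have "set us \<subseteq> f ` (S \<union> m_inv G ` S)" by (simp add: represents_def inv image_Un)
    then have "us \<in> lists (f ` (S \<union> m_inv G ` S))" by auto
    then obtain ws where ws: "us = map f ws" "set ws \<subseteq> S \<union> m_inv G ` S"
      unfolding lists_image by auto
    then have "represents G S ws (foldr (mult G) ws (one G))" "h = f (foldr (mult G) ws (one G))"
      using us word[OF ws(2)] by (auto simp: represents_def)
    then show "h \<in> f ` word_ball G S n"
      using us ws group.word_ball_iff[OF G S gen] by (metis imageI length_map)
  next
    fix h assume "h \<in> f ` word_ball G S n"
    then obtain ws where ws: "length ws \<le> n" "represents G S ws (foldr (mult G) ws (one G))"
      "h = f (foldr (mult G) ws (one G))" using group.word_ball_iff[OF G S gen]
      by (auto simp: represents_def)
    then have "represents H (f ` S) (map f ws) h" using word[of ws] inv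
      by (auto simp: represents_def)
    then show "h \<in> word_ball H (f ` S) n" using ws(1) group.word_ball_iff[OF H SH gH]
      by (metis length_map)
  qed
qed

theorem growth_rate_in_Omega2:
  fixes G (structure)
  assumes "two_generated G S"
  shows "growth_rate G S \<in> Omega2"
proof -
  from assms have G: "group G" and S: "S \<subseteq> carrier G" and card: "card S = 2"
    and gen: "generate G S = carrier G" by (auto simp: two_generated_def)
  interpret group G by (rule G)
  have fin: "finite S" using card by (rule_tac card_ge_0_finite) simp
  have "carrier G \<subseteq> (\<lambda>ws. foldr (mult G) ws (one G)) ` lists (S \<union> m_inv G ` S)"
    using generate_represents[OF S] gen by (force simp: represents_def)
  moreover have "countable (lists (S \<union> m_inv G ` S))"
    using fin by (intro countable_lists countable_finite) auto
  ultimately have "countable (carrier G)" by (meson countable_image countable_subset)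
  then obtain f :: "'a \<Rightarrow> nat" where f: "inj_on f (carrier G)" by (auto simp: countable_def)
  define k where "k = inv_into (carrier G) f"
  have k: "k (f x) = x" if "x \<in> carrier G" for x using that f by (simp add: k_def)
  define H where "H = \<lparr>carrier = f ` carrier G, mult = (\<lambda>x y. f (k x \<otimes> k y)), one = f \<one>\<rparr>"
  have H: "group H"
  proof (rule groupI)
    fix x assume "x \<in> carrier H"
    then obtain g where g: "g \<in> carrier G" "x = f g" by (auto simp: H_def)
    then have "f (inv g) \<in> carrier H" "f (inv g) \<otimes>\<^bsub>H\<^esub> x = \<one>\<^bsub>H\<^esub>" by (auto simp: H_def k)
    then show "\<exists>y\<in>carrier H. y \<otimes>\<^bsub>H\<^esub> x = \<one>\<^bsub>H\<^esub>" by blast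
  qed (auto simp: H_def k m_assoc)
  have iso: "f \<in> iso G H" using f by (auto simp: iso_def hom_def H_def bij_betw_def k)
  note * = word_ball_iso[OF G H S gen iso]
  have "card (word_ball H (f ` S) n) = card (word_ball G S n)" for n
    unfolding *(2) by (rule card_image) (use f in \<open>auto simp: inj_on_def word_ball_def\<close>)
  then have "growth_rate H (f ` S) = growth_rate G S" by (simp add: growth_rate_def)
  moreover have "two_generated H (f ` S)" unfolding two_generated_def
    using H *(1) S card f by (auto simp: H_def card_image inj_on_subset)
  ultimately show ?thesis using growth_rate_LIMSEQ(2)[OF G S fin gen] unfolding Omega2_def
    by (metis (mono_tags, lifting) mem_Collect_eq)
qed

end

theory Submission
  imports Defs
begin

text \<open>
  For a set \<open>A\<close> of natural numbers, let the group generated by lamps \<open>x\<^sub>i\<close> (\<open>i\<close> an integer) of order two be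
  nilpotent of class two, with independent commutators \<open>z\<^sub>i\<^sub>,\<^sub>k = [x\<^sub>i, x\<^sub>i\<^sub>+\<^sub>k\<^sub>+\<^sub>1]\<close> of order two for \<open>k \<in> A\<close>
  and trivial ones for \<open>k \<notin> A\<close>; its extension by the shift \<open>t\<close> is generated by \<open>t\<close> and \<open>x\<^sub>0\<close>. The growth
  rate is monotone in \<open>A\<close>, and since the ball of radius \<open>n\<close> only sees \<open>A \<inter> {..<n}\<close>, adding
  large elements to \<open>A\<close> increases the rate arbitrarily little. It does increase strictly when \<open>k \<notin> F\<close>
  is added to a finite set \<open>F\<close>: most elements of the ball visit linearly many sites, and
  inserting the commutator word for \<open>z\<^sub>i\<^sub>,\<^sub>k\<close> at \<open>m\<close> of these sites costs \<open>O(m)\<close> letters, but gives a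
  binomial number of new elements, which wins for small \<open>m / n\<close>. Hence along a sufficiently sparse sequence \<open>k\<^sub>0 < k\<^sub>1 < \<dots>\<close>
  the rate of \<open>{k\<^sub>m | m \<in> X}\<close> is strictly monotone in the lexicographic order of \<open>X\<close>.
\<close>

section \<open>Walks of a lamplighter\<close>

datatype letter = Flip | Fwd | Back

instance letter :: finite
proof
  have "(UNIV :: letter set) = {Flip, Fwd, Back}" using letter.exhaust by auto
  then show "finite (UNIV :: letter set)" by (metis finite.simps)
qed

text \<open>Normal form of a group element: the exponents of the lamps, the exponents of the central
  commutators, and the power of the shift.\<close>

type_synonym state = "(int \<Rightarrow> bool) \<times> (int \<Rightarrow> nat \<Rightarrow> bool) \<times> int"

text \<open>Words are read from right to left, so that prepending a letter is left multiplication by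
  a generator.\<close>

fun disp :: "letter \<Rightarrow> int" where
  "disp Flip = 0" | "disp Fwd = 1" | "disp Back = -1"

primrec pos :: "letter list \<Rightarrow> int" where
  "pos [] = 0"
| "pos (x # w) = disp x + pos w"

primrec lamp :: "letter list \<Rightarrow> int \<Rightarrow> bool" where
  "lamp [] i = False"
| "lamp (x # w) i = (lamp w i \<noteq> (x = Flip \<and> i = pos w))"

text \<open>The bit \<open>edge w i k\<close> is the exponent of the central commutator of the lamps \<open>i\<close> and \<open>i + k + 1\<close>;
  it changes when the lamp \<open>i\<close> is moved past the lamp \<open>i + k + 1\<close>.\<close>

primrec edge :: "letter list \<Rightarrow> int \<Rightarrow> nat \<Rightarrow> bool" where
  "edge [] i k = False"
| "edge (x # w) i k = (edge w i k \<noteq> (x = Flip \<and> i = pos w \<and> lamp w (i + int k + 1)))"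

primrec visited :: "letter list \<Rightarrow> int set" where
  "visited [] = {0}"
| "visited (x # w) = insert (disp x + pos w) (visited w)"

text \<open>\<open>edge\<close> tracks all commutators and \<open>A\<close> merely masks them, so
  that one word can be evaluated in the groups of different \<open>A\<close> and compared.\<close>

definition ev :: "nat set \<Rightarrow> letter list \<Rightarrow> state" where
  "ev A w = (lamp w, \<lambda>i k. k \<in> A \<and> edge w i k, pos w)"

definition ball_size :: "nat set \<Rightarrow> nat \<Rightarrow> nat" where
  "ball_size A n = card (ev A ` {w. length w \<le> n})"

lemma finite_words: "finite {w :: letter list. length w \<le> n}"
  using finite_lists_length_le[of "UNIV :: letter set" n] by simp

lemma finite_ball: "finite (ev A ` {w. length w \<le> n})"
  using finite_words by blast

text \<open>A letter moves the walker by at most one, so the visited sites are contiguous. A lamp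
  changes only at the walker's site, and \<open>edge w i k\<close> only when the walker is at
  \<open>i\<close> and the lamp at \<open>i + k + 1\<close> is lit; both sites then lie in the
  interval.\<close>

lemma visited_interval:
  "\<exists>lo hi. visited w = {lo..hi} \<and> lo \<le> 0 \<and> 0 \<le> hi \<and> hi - lo \<le> int (length w)
     \<and> lo \<le> pos w \<and> pos w \<le> hi \<and> (\<forall>i. lamp w i \<longrightarrow> lo \<le> i \<and> i \<le> hi)
     \<and> (\<forall>i k. edge w i k \<longrightarrow> lo \<le> i \<and> i + int k + 1 \<le> hi)"
proof (induction w)
  case Nil
  show ?case by (rule exI[of _ 0], rule exI[of _ 0]) auto
next
  case (Cons x w)
  then obtain lo hi where *: "visited w = {lo..hi}" "lo \<le> 0" "0 \<le> hi" "hi - lo \<le> int (length w)"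
     "lo \<le> pos w" "pos w \<le> hi" "\<And>i. lamp w i \<Longrightarrow> lo \<le> i \<and> i \<le> hi"
     "\<And>i k. edge w i k \<Longrightarrow> lo \<le> i \<and> i + int k + 1 \<le> hi" by blast
  define lo' hi' where "lo' = min lo (disp x + pos w)" and "hi' = max hi (disp x + pos w)"
  have d: "-1 \<le> disp x \<and> disp x \<le> 1" by (cases x) auto
  have "visited (x # w) = {lo'..hi'}"
    using * d unfolding lo'_def hi'_def by auto
  moreover have "lo' \<le> 0" "0 \<le> hi'" "lo' \<le> pos (x # w)" "pos (x # w) \<le> hi'"
    using * by (auto simp: lo'_def hi'_def)
  moreover have "hi' - lo' \<le> int (length (x # w))"
    using * d by (auto simp: lo'_def hi'_def)
  moreover have "lo' \<le> i \<and> i \<le> hi'" if "lamp (x # w) i" for i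
    using that *(5,6) *(7)[of i] by (auto simp: lo'_def hi'_def)
  moreover have "lo' \<le> i \<and> i + int k + 1 \<le> hi'" if "edge (x # w) i k" for i k
  proof (cases "edge w i k")
    case True
    then show ?thesis using *(8)[of i k] by (auto simp: lo'_def hi'_def)
  next
    case False
    then show ?thesis using that *(5) *(7)[of "i + int k + 1"] by (auto simp: lo'_def hi'_def)
  qed
  ultimately show ?case by blast
qed

text \<open>A set bit \<open>edge w i k\<close> needs two visited sites at distance
  \<open>k + 1\<close>, which forces \<open>k < n\<close> for a word of length at most
  \<open>n\<close>.\<close>

lemma ball_size_local:
  assumes "A \<inter> {..<n} = B \<inter> {..<n}"
  shows "ball_size A n = ball_size B n"
proof -
  have "ev A w = ev B w" if w: "length w \<le> n" for w
  proof -
    have "k < n" if "edge w i k" for i k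
    proof -
      obtain lo hi where *: "hi - lo \<le> int (length w)" "\<And>i k. edge w i k \<Longrightarrow> lo \<le> i \<and> i + int k + 1 \<le> hi"
        using visited_interval[of w] by blast
      show ?thesis using *(1) *(2)[OF that] w by linarith
    qed
    then have "(k \<in> A \<and> edge w i k) = (k \<in> B \<and> edge w i k)" for i k using assms by blast
    then show ?thesis by (simp add: ev_def)
  qed
  then show ?thesis unfolding ball_size_def by (intro arg_cong[of _ _ card] image_cong) auto
qed

text \<open>The projection killing the commutators outside \<open>A\<close>; on values of words it
  maps the group of a larger set onto that of \<open>A\<close>.\<close>

definition restrict_edges :: "nat set \<Rightarrow> state \<Rightarrow> state" where
  "restrict_edges A = (\<lambda>(S, E, p). (S, \<lambda>i k. k \<in> A \<and> E i k, p))"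

lemma restrict_edges_ev: "A \<subseteq> B \<Longrightarrow> restrict_edges A (ev B w) = ev A w"
  by (auto simp: restrict_edges_def ev_def fun_eq_iff)

lemma ball_size_mono:
  assumes "A \<subseteq> B"
  shows "ball_size A n \<le> ball_size B n"
proof -
  have "ev A ` {w. length w \<le> n} = restrict_edges A ` ev B ` {w. length w \<le> n}"
    by (simp add: image_image restrict_edges_ev[OF assms])
  then show ?thesis unfolding ball_size_def using card_image_le[OF finite_ball] by metis
qed

section \<open>Commutator words and their insertion into walks\<close>

lemma pos_append_replicate: "pos (replicate n x @ w) = int n * disp x + pos w"
  by (induction n) (auto simp: algebra_simps)

lemma lamp_append_replicate: "x \<noteq> Flip \<Longrightarrow> lamp (replicate n x @ w) = lamp w"
  by (induction n) auto

lemma edge_append_replicate: "x \<noteq> Flip \<Longrightarrow> edge (replicate n x @ w) = edge w"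
  by (induction n) (auto simp: fun_eq_iff)

text \<open>The commutator of the lamp at the walker's site and the lamp \<open>k + 1\<close>
  further right, returning to the start. Both lamps are involutions, so it is the square of their
  product.\<close>

definition comm_word :: "nat \<Rightarrow> letter list" where
  "comm_word k = replicate (Suc k) Back @ [Flip] @ replicate (Suc k) Fwd @ [Flip]
     @ replicate (Suc k) Back @ [Flip] @ replicate (Suc k) Fwd @ [Flip]"

lemma length_comm_word: "length (comm_word k) = 4 * k + 8"
  by (simp add: comm_word_def)

text \<open>Each of the two lamps is flipped twice. Between the two flips at \<open>pos w\<close>,
  the only lamp to its right that changes is the one at distance \<open>k + 1\<close>, so exactly
  one bit survives there. The two flips at the far site see the same lamps to their right and
  cancel.\<close>

lemma comm_word_append:
  "pos (comm_word k @ w) = pos w"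
  "lamp (comm_word k @ w) = lamp w"
  "edge (comm_word k @ w) i j = (edge w i j \<noteq> (i = pos w \<and> j = k))"
proof -
  define w1 where "w1 = Flip # w"
  define w2 where "w2 = Flip # replicate (Suc k) Fwd @ w1"
  define w3 where "w3 = Flip # replicate (Suc k) Back @ w2"
  define w4 where "w4 = Flip # replicate (Suc k) Fwd @ w3"
  have w: "comm_word k @ w = replicate (Suc k) Back @ w4"
    by (simp add: comm_word_def w1_def w2_def w3_def w4_def)
  have p1: "pos w1 = pos w" by (simp add: w1_def)
  have p2: "pos w2 = pos w + int k + 1"
    using p1 by (simp only: w2_def pos.simps pos_append_replicate) simp
  have p3: "pos w3 = pos w"
    using p2 by (simp only: w3_def pos.simps pos_append_replicate) simp
  have p4: "pos w4 = pos w + int k + 1"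
    using p3 by (simp only: w4_def pos.simps pos_append_replicate) simp
  have q: "pos (replicate (Suc k) Fwd @ w1) = pos w + int k + 1"
      "pos (replicate (Suc k) Back @ w2) = pos w"
      "pos (replicate (Suc k) Fwd @ w3) = pos w + int k + 1"
    using p1 p2 p3 by (simp_all only: pos_append_replicate) simp_all
  have l1: "lamp w1 i = (lamp w i \<noteq> (i = pos w))" for i by (simp add: w1_def)
  have l2: "lamp w2 i = (lamp w1 i \<noteq> (i = pos w + int k + 1))" for i
    by (simp only: w2_def lamp.simps lamp_append_replicate letter.distinct not_False_eq_True q) simp
  have l3: "lamp w3 i = (lamp w2 i \<noteq> (i = pos w))" for i
    by (simp only: w3_def lamp.simps lamp_append_replicate letter.distinct not_False_eq_True q) simp
  have l4: "lamp w4 i = (lamp w3 i \<noteq> (i = pos w + int k + 1))" for i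
    by (simp only: w4_def lamp.simps lamp_append_replicate letter.distinct not_False_eq_True q) simp
  have e1: "edge w1 i j = (edge w i j \<noteq> (i = pos w \<and> lamp w (i + int j + 1)))" for i j
    by (simp add: w1_def)
  have e2: "edge w2 i j = (edge w1 i j \<noteq> (i = pos w + int k + 1 \<and> lamp w1 (i + int j + 1)))" for i j
    by (simp only: w2_def edge.simps edge_append_replicate lamp_append_replicate letter.distinct
        not_False_eq_True q) simp
  have e3: "edge w3 i j = (edge w2 i j \<noteq> (i = pos w \<and> lamp w2 (i + int j + 1)))" for i j
    by (simp only: w3_def edge.simps edge_append_replicate lamp_append_replicate letter.distinct
        not_False_eq_True q) simp
  have e4: "edge w4 i j = (edge w3 i j \<noteq> (i = pos w + int k + 1 \<and> lamp w3 (i + int j + 1)))" for i j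
    by (simp only: w4_def edge.simps edge_append_replicate lamp_append_replicate letter.distinct
        not_False_eq_True q) simp
  show "pos (comm_word k @ w) = pos w"
    unfolding w using p4 by (simp only: pos_append_replicate) simp
  show "lamp (comm_word k @ w) = lamp w"
    unfolding w by (rule ext) (simp only: lamp_append_replicate letter.distinct not_False_eq_True l1 l2 l3 l4, blast)
  show "edge (comm_word k @ w) i j = (edge w i j \<noteq> (i = pos w \<and> j = k))"
    unfolding w by (auto simp only: edge_append_replicate letter.distinct not_False_eq_True e1 e2 e3 e4 l1 l2 l3)
qed

text \<open>The commutator word is inserted at the first visit to each site of \<open>P\<close>. It
  restores position and lamps, so the rest of the walk proceeds as before.\<close>

lemma insert_commutators:
  assumes "P \<subseteq> visited w"
  shows "\<exists>w'. length w' = length w + card P * (4 * k + 8) \<and> pos w' = pos w \<and> lamp w' = lamp w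
    \<and> (\<forall>i j. edge w' i j = (edge w i j \<noteq> (i \<in> P \<and> j = k)))"
  using assms
proof (induction w arbitrary: P)
  case Nil
  show ?case
  proof (cases "P = {}")
    case True
    then show ?thesis by (intro exI[of _ "[]"]) auto
  next
    case False
    then have "P = {0}" using Nil by auto
    then show ?thesis using comm_word_append[of k "[]"]
      by (intro exI[of _ "comm_word k @ []"]) (auto simp: length_comm_word)
  qed
next
  case (Cons x w)
  \<comment> \<open>The letter \<open>x\<close> reaches at most one new site; the sites in
    \<open>Q\<close> are already served by the induction hypothesis.\<close>
  define Q where "Q = P \<inter> visited w"
  obtain w' where w': "length w' = length w + card Q * (4 * k + 8)" "pos w' = pos w" "lamp w' = lamp w"
    "\<And>i j. edge w' i j = (edge w i j \<noteq> (i \<in> Q \<and> j = k))"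
    using Cons.IH[of Q] unfolding Q_def by auto
  define u where "u = x # w'"
  have u: "length u = length (x # w) + card Q * (4 * k + 8)" "pos u = pos (x # w)" "lamp u = lamp (x # w)"
    "\<And>i j. edge u i j = (edge (x # w) i j \<noteq> (i \<in> Q \<and> j = k))"
    using w' by (auto simp: u_def)
  show ?case
  proof (cases "P \<subseteq> visited w")
    case True
    then have "Q = P" by (auto simp: Q_def)
    then show ?thesis using u by blast
  next
    case False
    let ?p = "pos (x # w)"
    have P: "P = insert ?p Q" "?p \<notin> Q" using False Cons.prems by (auto simp: Q_def)
    have "finite Q" using visited_interval[of w] unfolding Q_def by auto
    then have "card P = Suc (card Q)" using P by simp
    then have "length (comm_word k @ u) = length (x # w) + card P * (4 * k + 8)"
      by (simp add: u(1) length_comm_word)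
    moreover have "edge (comm_word k @ u) i j = (edge (x # w) i j \<noteq> (i \<in> P \<and> j = k))" for i j
      unfolding comm_word_append u(2,4) P(1) using P(2) by blast
    ultimately show ?thesis using u(2,3) comm_word_append(1,2)[of k u] by metis
  qed
qed

section \<open>Counting\<close>

text \<open>Walking right over \<open>m\<close> sites and flipping the lamps of any chosen subset
  costs at most two letters per site.\<close>

lemma ball_size_ge_pow: "2 ^ m \<le> ball_size A (2 * m)"
proof -
  have word: "\<exists>w. length w \<le> 2 * m \<and> pos w = int m \<and> lamp w = (\<lambda>i. i \<in> T)"
    if "T \<subseteq> {0..<int m}" for T :: "int set"
    using that
  proof (induction m arbitrary: T)
    case 0
    then show ?case by (intro exI[of _ "[]"]) auto
  next
    case (Suc m)
    obtain w where w: "length w \<le> 2 * m" "pos w = int m" "lamp w = (\<lambda>i. i \<in> T - {int m})"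
      using Suc.IH[of "T - {int m}"] Suc.prems by force
    show ?case
    proof (cases "int m \<in> T")
      case True
      then show ?thesis using w by (intro exI[of _ "Fwd # Flip # w"]) auto
    next
      case False
      then show ?thesis using w by (intro exI[of _ "Fwd # w"]) auto
    qed
  qed
  have "Pow {0..<int m} \<subseteq> (\<lambda>s. Collect (fst s)) ` ev A ` {w. length w \<le> 2 * m}"
  proof
    fix T assume "T \<in> Pow {0..<int m}"
    then obtain w where "length w \<le> 2 * m" "lamp w = (\<lambda>i. i \<in> T)" using word[of T] by auto
    then have "T = Collect (fst (ev A w))" "w \<in> {w. length w \<le> 2 * m}" by (auto simp: ev_def)
    then show "T \<in> (\<lambda>s. Collect (fst s)) ` ev A ` {w. length w \<le> 2 * m}" by blast
  qed
  then have "card (Pow {0..<int m}) \<le> ball_size A (2 * m)" unfolding ball_size_def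
    using surj_card_le[OF finite_ball] le_trans card_image_le finite_ball by blast
  then show ?thesis by (simp add: card_Pow)
qed

text \<open>The walk stays within distance \<open>r\<close> of the origin, so the state is given by
  a subset of \<open>I\<close>, a subset of \<open>I \<times> F\<close> and a point of
  \<open>I\<close>. The words may have any length.\<close>

lemma few_visited_sites:
  assumes "finite F"
  shows "finite {s. \<exists>w. s = ev F w \<and> card (visited w) \<le> r}"
    and "card {s. \<exists>w. s = ev F w \<and> card (visited w) \<le> r} \<le> 2 ^ ((2 * r + 1) * (card F + 2))"
proof -
  define I where "I = {- int r..int r}"
  define f :: "state \<Rightarrow> int set \<times> (int \<times> nat) set \<times> int"
    where "f = (\<lambda>(S, E, p). (Collect S, Collect (case_prod E), p))"
  let ?X = "{s. \<exists>w. s = ev F w \<and> card (visited w) \<le> r}"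
  let ?Y = "Pow I \<times> Pow (I \<times> F) \<times> I"
  have "inj f"
  proof (rule injI)
    fix s s' assume "f s = f s'"
    then show "s = s'" by (cases s; cases s') (auto simp: f_def fun_eq_iff set_eq_iff)
  qed
  moreover have "f ` ?X \<subseteq> ?Y"
  proof (intro image_subsetI)
    fix s assume "s \<in> ?X"
    then obtain w where s: "s = ev F w" and w: "card (visited w) \<le> r" by blast
    obtain lo hi where *: "visited w = {lo..hi}" "lo \<le> 0" "0 \<le> hi" "lo \<le> pos w" "pos w \<le> hi"
     "\<And>i. lamp w i \<Longrightarrow> lo \<le> i \<and> i \<le> hi" "\<And>i k. edge w i k \<Longrightarrow> lo \<le> i \<and> i + int k + 1 \<le> hi"
      using visited_interval[of w] by blast
    have r: "- int r \<le> lo" "hi \<le> int r" using w *(1-3) by auto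
    have "pos w \<in> I" using r *(4,5) unfolding I_def atLeastAtMost_iff by linarith
    moreover have "i \<in> I" if "lamp w i" for i
      using r *(6)[OF that] unfolding I_def atLeastAtMost_iff by linarith
    moreover have "i \<in> I" if "edge w i k" for i k
      using r *(7)[OF that] unfolding I_def atLeastAtMost_iff by linarith
    ultimately show "f s \<in> ?Y" by (auto simp: f_def ev_def s)
  qed
  moreover have fin: "finite ?Y" using assms by (simp add: I_def)
  ultimately show "finite ?X" by (meson finite_imageD finite_subset inj_on_subset subset_UNIV)
  have "card ?X \<le> card ?Y"
    using \<open>inj f\<close> \<open>f ` ?X \<subseteq> ?Y\<close> fin by (meson card_inj_on_le inj_on_subset subset_UNIV)
  also have "card ?Y = 2 ^ (2 * r + 1) * (2 ^ ((2 * r + 1) * card F) * (2 * r + 1))"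
    using assms by (simp add: card_cartesian_product card_Pow I_def nat_add_distrib nat_mult_distrib)
  also have "\<dots> \<le> 2 ^ (2 * r + 1) * (2 ^ ((2 * r + 1) * card F) * 2 ^ (2 * r + 1))"
    using less_exp[of "2 * r + 1"] by (intro mult_left_mono less_imp_le) auto
  also have "\<dots> = 2 ^ ((2 * r + 1) * (card F + 2))"
    by (simp add: power_add[symmetric] algebra_simps)
  finally show "card ?X \<le> 2 ^ ((2 * r + 1) * (card F + 2))" .
qed

text \<open>Fix a representative of each state that cannot be reached with few visited sites, and
  insert the commutators \<open>z\<^sub>i\<^sub>,\<^sub>k\<close> for \<open>i\<close> in an
  \<open>m\<close>-subset \<open>P\<close> of its sites. As \<open>k \<notin> F\<close>, the
  projection to \<open>F\<close> returns the state, and then the bits at \<open>k\<close> return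
  \<open>P\<close>.\<close>

lemma ball_size_insert:
  assumes k: "k \<notin> F" and m: "0 < m" and L: "0 < L"
  shows "card {s \<in> ev F ` {w. length w \<le> n}. \<nexists>w. s = ev F w \<and> card (visited w) \<le> L * m} * L ^ m
    \<le> ball_size (insert k F) (n + m * (4 * k + 8))"
proof -
  define good where "good = {s \<in> ev F ` {w. length w \<le> n}. \<nexists>w. s = ev F w \<and> card (visited w) \<le> L * m}"
  define rep where "rep s = (SOME w. length w \<le> n \<and> s = ev F w)" for s
  have rep: "length (rep s) \<le> n" "s = ev F (rep s)" if "s \<in> good" for s
  proof -
    have "\<exists>w. length w \<le> n \<and> s = ev F w" using that by (auto simp: good_def)
    from someI_ex[OF this] show "length (rep s) \<le> n" "s = ev F (rep s)" by (auto simp: rep_def)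
  qed
  define V where "V s = {P. P \<subseteq> visited (rep s) \<and> card P = m}" for s
  have fin_vis: "finite (visited w)" for w using visited_interval[of w] by auto
  have fin_good: "finite good" unfolding good_def using finite_ball by simp
  have fin_V: "finite (V s)" for s unfolding V_def using fin_vis by simp
  \<comment> \<open>Uses that \<open>N choose m\<close> is at least \<open>(N / m) ^ m\<close> for
    \<open>N \<ge> m\<close>, with \<open>N \<ge> L * m\<close> visited sites.\<close>
  have V: "L ^ m \<le> card (V s)" if "s \<in> good" for s
  proof -
    have c: "L * m \<le> card (visited (rep s))" using rep[OF that] that by (force simp: good_def)
    have "m \<le> L * m" using L by simp
    then have "m \<le> card (visited (rep s))" using c by linarith
    note binomial_ge_n_over_k_pow_k[OF this, where 'a = real]
    moreover have "real L \<le> real (card (visited (rep s))) / real m"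
      using c m by (simp add: field_simps flip: of_nat_mult)
    then have "real L ^ m \<le> (real (card (visited (rep s))) / real m) ^ m" by (intro power_mono) auto
    ultimately have "real (L ^ m) \<le> real (card (visited (rep s)) choose m)"
      unfolding of_nat_power by linarith
    then show ?thesis unfolding V_def n_subsets[OF fin_vis] by (simp only: of_nat_le_iff)
  qed
  define new where "new s P = (SOME w'. length w' = length (rep s) + m * (4 * k + 8) \<and> pos w' = pos (rep s)
    \<and> lamp w' = lamp (rep s) \<and> (\<forall>i j. edge w' i j = (edge (rep s) i j \<noteq> (i \<in> P \<and> j = k))))" for s P
  have new: "length (new s P) = length (rep s) + m * (4 * k + 8)" "pos (new s P) = pos (rep s)"
    "lamp (new s P) = lamp (rep s)" "\<And>i j. edge (new s P) i j = (edge (rep s) i j \<noteq> (i \<in> P \<and> j = k))"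
    if "P \<in> V s" for s P
  proof -
    have "\<exists>w'. length w' = length (rep s) + m * (4 * k + 8) \<and> pos w' = pos (rep s)
      \<and> lamp w' = lamp (rep s) \<and> (\<forall>i j. edge w' i j = (edge (rep s) i j \<noteq> (i \<in> P \<and> j = k)))"
      using insert_commutators[of P "rep s" k] that by (auto simp: V_def)
    from someI_ex[OF this] show "length (new s P) = length (rep s) + m * (4 * k + 8)"
      "pos (new s P) = pos (rep s)" "lamp (new s P) = lamp (rep s)"
      "\<And>i j. edge (new s P) i j = (edge (rep s) i j \<noteq> (i \<in> P \<and> j = k))"
      unfolding new_def by blast+
  qed
  have old: "ev F (new s P) = s" if "s \<in> good" "P \<in> V s" for s P
  proof -
    have "ev F (new s P) = ev F (rep s)" using new[OF that(2)] k by (auto simp: ev_def fun_eq_iff)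
    then show ?thesis using rep(2)[OF that(1)] by simp
  qed
  let ?g = "\<lambda>(s, P). ev (insert k F) (new s P)"
  have "inj_on ?g (Sigma good V)"
  proof (rule inj_onI, clarify)
    fix s P s' P'
    assume *: "s \<in> good" "P \<in> V s" "s' \<in> good" "P' \<in> V s'"
      "ev (insert k F) (new s P) = ev (insert k F) (new s' P')"
    from arg_cong[OF *(5), of "restrict_edges F"] have "ev F (new s P) = ev F (new s' P')"
      by (simp only: restrict_edges_ev[OF subset_insertI])
    then have s: "s = s'" using old * by simp
    have "edge (new s P) i k = edge (new s P') i k" for i
      using *(5) s by (auto simp: ev_def fun_eq_iff)
    then have "(edge (rep s) i k \<noteq> (i \<in> P)) = (edge (rep s) i k \<noteq> (i \<in> P'))" for i
      using new(4) *(2,4) s by simp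
    then have "P = P'" by blast
    with s show "s = s' \<and> P = P'" by simp
  qed
  moreover have "?g ` Sigma good V \<subseteq> ev (insert k F) ` {w. length w \<le> n + m * (4 * k + 8)}"
    using new(1) rep(1) by fastforce
  ultimately have "card (Sigma good V) \<le> ball_size (insert k F) (n + m * (4 * k + 8))"
    unfolding ball_size_def using card_inj_on_le finite_ball by blast
  moreover have "card good * L ^ m \<le> card (Sigma good V)"
    using fin_good fin_V V sum_mono[of good "\<lambda>_. L ^ m" "\<lambda>s. card (V s)"] by (simp add: card_SigmaI)
  ultimately show ?thesis by (simp add: good_def)
qed

text \<open>\<open>D\<close> is chosen so that at least half of the ball of radius
  \<open>D * m\<close> needs more than \<open>L * m\<close> sites: the ball has at least
  \<open>2 ^ (D * m div 2)\<close> elements, and the exponent bounding the others is smaller by at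
  least one.\<close>

lemma ball_size_gain:
  assumes F: "finite F" and k: "k \<notin> F" and m: "0 < m" and L: "0 < L"
    and D: "D = 2 * ((2 * L + 1) * (card F + 2) + 1)"
  shows "ball_size F (D * m) * L ^ m \<le> 2 * ball_size (insert k F) ((D + 4 * k + 8) * m)"
proof -
  let ?q = "(2 * (L * m) + 1) * (card F + 2)"
  let ?B = "ev F ` {w. length w \<le> D * m}"
  let ?bad = "{s. \<exists>w. s = ev F w \<and> card (visited w) \<le> L * m}"
  let ?good = "{s \<in> ?B. \<nexists>w. s = ev F w \<and> card (visited w) \<le> L * m}"
  have "?q + 1 \<le> ((2 * L + 1) * (card F + 2) + 1) * m"
  proof -
    have "2 * (L * m) + 1 \<le> (2 * L + 1) * m" using m by (simp add: algebra_simps)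
    then have "?q \<le> ((2 * L + 1) * m) * (card F + 2)" by (rule mult_right_mono) simp
    then have "?q + 1 \<le> ((2 * L + 1) * m) * (card F + 2) + m" using m by linarith
    then show ?thesis by (simp add: algebra_simps)
  qed
  then have "(2::nat) ^ (?q + 1) \<le> 2 ^ (((2 * L + 1) * (card F + 2) + 1) * m)"
    by (intro power_increasing) auto
  also have "\<dots> \<le> ball_size F (D * m)" using ball_size_ge_pow[of "((2 * L + 1) * (card F + 2) + 1) * m" F]
    by (simp only: D mult.assoc)
  finally have half: "2 * 2 ^ ?q \<le> ball_size F (D * m)" by simp
  have "card (?B - ?good) \<le> 2 ^ ?q"
  proof -
    have "card (?B - ?good) \<le> card ?bad" by (intro card_mono few_visited_sites(1)[OF F]) auto
    then show ?thesis using few_visited_sites(2)[OF F, of "L * m"] by linarith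
  qed
  moreover have "card ?B \<le> card ?good + card (?B - ?good)"
  proof -
    have "card (?good \<union> (?B - ?good)) \<le> card ?good + card (?B - ?good)" by (rule card_Un_le)
    moreover have "?good \<union> (?B - ?good) = ?B" by blast
    ultimately show ?thesis by simp
  qed
  ultimately have "ball_size F (D * m) \<le> 2 * card ?good"
    using half unfolding ball_size_def by linarith
  then have "ball_size F (D * m) * L ^ m \<le> 2 * (card ?good * L ^ m)" by simp
  also have "\<dots> \<le> 2 * ball_size (insert k F) (D * m + m * (4 * k + 8))"
    using ball_size_insert[OF k m L, of "D * m"] by simp
  also have "D * m + m * (4 * k + 8) = (D + 4 * k + 8) * m" by (simp add: algebra_simps)
  finally show ?thesis .
qed

section \<open>The groups\<close>

text \<open>A central extension of a lamplighter group: the left factor is translated by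
  \<open>p\<close>, and the last term of the second component is the exponent gained when its lamp
  at \<open>i\<close> passes the lamp at \<open>i + k + 1\<close> of the right factor. Supports may
  be infinite here; \<open>shift_group\<close> cuts down to the subgroup generated by the two
  generators.\<close>

definition lamp_group :: "nat set \<Rightarrow> state monoid" where
  "lamp_group A = \<lparr>carrier = UNIV,
     mult = (\<lambda>(S', E', p') (S, E, p). (\<lambda>i. S i \<noteq> S' (i - p),
       \<lambda>i k. (E i k \<noteq> E' (i - p) k) \<noteq> (k \<in> A \<and> S (i + int k + 1) \<and> S' (i - p)), p' + p)),
     one = (\<lambda>i. False, \<lambda>i k. False, 0)\<rparr>"

fun gen :: "letter \<Rightarrow> state" where
  "gen Flip = (\<lambda>i. i = 0, \<lambda>i k. False, 0)"
| "gen Fwd = (\<lambda>i. False, \<lambda>i k. False, 1)"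
| "gen Back = (\<lambda>i. False, \<lambda>i k. False, -1)"

lemma group_lamp_group: "group (lamp_group A)"
proof (rule groupI)
  fix x y z assume "x \<in> carrier (lamp_group A)" "y \<in> carrier (lamp_group A)" "z \<in> carrier (lamp_group A)"
  obtain S1 E1 p1 S2 E2 p2 S3 E3 p3 where x: "x = (S1, E1, p1)" "y = (S2, E2, p2)" "z = (S3, E3, p3)"
    by (metis prod_cases3)
  have shift: "i - (p2 + p3) = i - p3 - p2" "i + int k + 1 - p3 = i - p3 + int k + 1" for i k by auto
  \<comment> \<open>The cocycle identity: the correction term is bilinear over the field with two
    elements.\<close>
  have cocycle: "((((e3 \<noteq> e2) \<noteq> (a \<and> s3 \<and> s2)) \<noteq> e1) \<noteq> (a \<and> (s3 \<noteq> s2') \<and> s1)) =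
    ((e3 \<noteq> ((e2 \<noteq> e1) \<noteq> (a \<and> s2' \<and> s1))) \<noteq> (a \<and> s3 \<and> (s2 \<noteq> s1)))" for e1 e2 e3 a s1 s2 s2' s3
    by argo
  show "x \<otimes>\<^bsub>lamp_group A\<^esub> y \<otimes>\<^bsub>lamp_group A\<^esub> z = x \<otimes>\<^bsub>lamp_group A\<^esub> (y \<otimes>\<^bsub>lamp_group A\<^esub> z)"
    unfolding x lamp_group_def monoid.simps case_prod_conv shift cocycle by (simp add: fun_eq_iff) blast
next
  fix x assume "x \<in> carrier (lamp_group A)"
  obtain S E p where x: "x = (S, E, p)" by (metis prod_cases3)
  show "\<exists>y\<in>carrier (lamp_group A). y \<otimes>\<^bsub>lamp_group A\<^esub> x = \<one>\<^bsub>lamp_group A\<^esub>"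
    \<comment> \<open>The extra term in the second component cancels the correction that arises when
      \<open>S\<close> meets its own translate.\<close>
    by (rule bexI[of _ "(\<lambda>i. S (i + p),
        \<lambda>i k. E (i + p) k \<noteq> (k \<in> A \<and> S (i + p + int k + 1) \<and> S (i + p)), -p)"])
      (auto simp: lamp_group_def x fun_eq_iff)
qed (auto simp: lamp_group_def)

text \<open>Left multiplication by a generator changes a state exactly as the recursions for
  \<open>lamp\<close>, \<open>edge\<close> and \<open>pos\<close> prescribe.\<close>

lemma foldr_gen: "foldr (mult (lamp_group A)) (map gen w) (one (lamp_group A)) = ev A w"
proof (induction w)
  case Nil
  then show ?case by (simp add: lamp_group_def ev_def fun_eq_iff)
next
  case (Cons x w)
  then show ?case by (cases x) (auto simp: lamp_group_def ev_def fun_eq_iff)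
qed

declare gen.simps [simp del]

definition shift_group :: "nat set \<Rightarrow> state monoid" where
  "shift_group A = (lamp_group A)\<lparr>carrier := generate (lamp_group A) {gen Flip, gen Fwd}\<rparr>"

lemma subgroup_shift_group: "subgroup (generate (lamp_group A) {gen Flip, gen Fwd}) (lamp_group A)"
  by (rule group.generate_is_subgroup[OF group_lamp_group]) (simp add: lamp_group_def)

lemma group_shift_group: "group (shift_group A)"
  unfolding shift_group_def by (rule subgroup.subgroup_is_group[OF subgroup_shift_group group_lamp_group])

lemma gens_subset: "{gen Flip, gen Fwd} \<subseteq> carrier (shift_group A)"
  unfolding shift_group_def by (auto intro: generate.incl)

lemma generate_shift_group: "generate (shift_group A) {gen Flip, gen Fwd} = carrier (shift_group A)"
  using group.generate_consistent[OF group_lamp_group _ subgroup_shift_group] gens_subset by (simp add: shift_group_def)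

lemma two_generated_shift_group: "two_generated (shift_group A) {gen Flip, gen Fwd}"
  unfolding two_generated_def using group_shift_group gens_subset generate_shift_group
  by (simp add: card_insert_if gen.simps)

text \<open>The flip is its own inverse, so three letters exhaust the generators and their
  inverses.\<close>

lemma letters_shift_group: "{gen Flip, gen Fwd} \<union> m_inv (shift_group A) ` {gen Flip, gen Fwd} = range gen"
proof -
  interpret H: group "lamp_group A" by (rule group_lamp_group)
  have inv: "inv\<^bsub>shift_group A\<^esub> x = inv\<^bsub>lamp_group A\<^esub> x" if "x \<in> {gen Flip, gen Fwd}" for x
    unfolding shift_group_def by (rule H.m_inv_consistent[OF subgroup_shift_group generate.incl[OF that]])
  have "inv\<^bsub>lamp_group A\<^esub> (gen Flip) = gen Flip" "inv\<^bsub>lamp_group A\<^esub> (gen Fwd) = gen Back"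
    by (rule H.inv_equality; simp add: lamp_group_def gen.simps fun_eq_iff)+
  then have "inv\<^bsub>shift_group A\<^esub> (gen Flip) = gen Flip" "inv\<^bsub>shift_group A\<^esub> (gen Fwd) = gen Back" using inv by auto
  moreover have "(UNIV :: letter set) = {Flip, Fwd, Back}" using letter.exhaust by auto
  then have "range gen = {gen Flip, gen Fwd, gen Back}"
    by (metis image_empty image_insert)
  ultimately show ?thesis by auto
qed

lemma word_ball_shift_group: "word_ball (shift_group A) {gen Flip, gen Fwd} n = ev A ` {w. length w \<le> n}"
proof -
  have "(\<exists>ws. length ws \<le> n \<and> represents (shift_group A) {gen Flip, gen Fwd} ws g) \<longleftrightarrow> (\<exists>w. length w \<le> n \<and> g = ev A w)" for g
  proof -
    have "represents (shift_group A) {gen Flip, gen Fwd} ws g \<longleftrightarrow> (\<exists>w. ws = map gen w \<and> g = ev A w)" for ws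
    proof -
      have "set ws \<subseteq> range gen \<longleftrightarrow> (\<exists>w. ws = map gen w)"
        using lists_image[of gen UNIV] by (auto simp: lists_eq_set)
      then show ?thesis unfolding represents_def letters_shift_group using foldr_gen by (auto simp: shift_group_def)
    qed
    then show ?thesis by (metis length_map)
  qed
  then show ?thesis using group.word_ball_iff[OF group_shift_group gens_subset generate_shift_group] by blast
qed

section \<open>Growth rates\<close>

definition rate :: "nat set \<Rightarrow> real" where
  "rate A = growth_rate (shift_group A) {gen Flip, gen Fwd}"

lemma rate_in_Omega2: "rate A \<in> Omega2"
  unfolding rate_def by (rule growth_rate_in_Omega2[OF two_generated_shift_group])

lemma card_word_ball_shift_group: "card (word_ball (shift_group A) {gen Flip, gen Fwd} n) = ball_size A n"
  by (simp add: word_ball_shift_group ball_size_def)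

lemma rate_LIMSEQ: "(\<lambda>n. root n (real (ball_size A n))) \<longlonglongrightarrow> rate A"
  and rate_ge_1: "1 \<le> rate A"
  using growth_rate_LIMSEQ[OF group_shift_group gens_subset _ generate_shift_group, of A]
  unfolding card_word_ball_shift_group rate_def by auto

lemma ball_size_add: "ball_size A (m + n) \<le> ball_size A m * ball_size A n"
  using group.card_word_ball_add[OF group_shift_group gens_subset _ generate_shift_group, of A m n]
  unfolding card_word_ball_shift_group by simp

lemma ball_size_0: "ball_size A 0 = 1"
  by (simp add: ball_size_def)

lemma ball_size_1: "ball_size A 1 \<le> 4"
proof -
  have "{w. length w \<le> 1} = {[], [Flip], [Fwd], [Back]}"
    using letter.exhaust by (auto simp: le_Suc_eq length_Suc_conv)
  then have "ev A ` {w. length w \<le> 1} = {ev A [], ev A [Flip], ev A [Fwd], ev A [Back]}" by simp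
  then show ?thesis using card_length[of "[ev A [], ev A [Flip], ev A [Fwd], ev A [Back]]"]
    by (simp add: ball_size_def)
qed

lemma ball_size_mult: "ball_size A (n * m) \<le> ball_size A n ^ m"
proof (induction m)
  case (Suc m)
  have "ball_size A (n + n * m) \<le> ball_size A n * ball_size A (n * m)" by (rule ball_size_add)
  also have "\<dots> \<le> ball_size A n * ball_size A n ^ m" using Suc by simp
  finally show ?case by simp
qed (simp add: ball_size_0)

lemma ball_size_multiple_LIMSEQ:
  assumes "0 < n"
  shows "(\<lambda>m. root m (real (ball_size A (n * m)))) \<longlonglongrightarrow> rate A ^ n"
proof -
  have "(\<lambda>m. root (n * m) (real (ball_size A (n * m)))) \<longlonglongrightarrow> rate A"
    using LIMSEQ_subseq_LIMSEQ[OF rate_LIMSEQ, of "\<lambda>m. n * m" A] assms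
    by (simp add: strict_mono_def comp_def)
  then have "(\<lambda>m. root (n * m) (real (ball_size A (n * m))) ^ n) \<longlonglongrightarrow> rate A ^ n"
    by (rule tendsto_power)
  moreover have "\<forall>\<^sub>F m in sequentially. root (n * m) (real (ball_size A (n * m))) ^ n = root m (real (ball_size A (n * m)))"
    by (rule eventually_sequentiallyI[of 1]) (use assms in \<open>simp add: real_root_mult_exp real_root_pow_pos2 flip: real_root_power\<close>)
  ultimately show ?thesis by (rule Lim_transform_eventually)
qed

text \<open>By submultiplicativity, \<open>ball_size A (n * m)\<close> is at most the
  \<open>m\<close>-th power of \<open>ball_size A n\<close>; take \<open>m\<close>-th roots and let
  \<open>m\<close> grow.\<close>

lemma rate_pow_le_ball_size:
  assumes "0 < n"
  shows "rate A ^ n \<le> real (ball_size A n)"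
proof (rule LIMSEQ_le_const2[OF ball_size_multiple_LIMSEQ[OF assms]])
  have "root m (real (ball_size A (n * m))) \<le> real (ball_size A n)" if "1 \<le> m" for m
  proof -
    have "real (ball_size A (n * m)) \<le> real (ball_size A n) ^ m"
      using ball_size_mult[of A n m] by (simp flip: of_nat_power)
    then have "root m (real (ball_size A (n * m))) \<le> root m (real (ball_size A n) ^ m)"
      using that by (intro real_root_le_mono) auto
    then show ?thesis using that by (simp add: real_root_power_cancel)
  qed
  then show "\<exists>N. \<forall>m\<ge>N. root m (real (ball_size A (n * m))) \<le> real (ball_size A n)" by blast
qed

section \<open>Monotonicity, strict increase and semicontinuity of the rate\<close>

lemma rate_mono:
  assumes "A \<subseteq> B"
  shows "rate A \<le> rate B"
proof (rule LIMSEQ_le[OF rate_LIMSEQ rate_LIMSEQ])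
  have "root n (real (ball_size A n)) \<le> root n (real (ball_size B n))" if "1 \<le> n" for n
    using that ball_size_mono[OF assms, of n] by (intro real_root_le_mono) auto
  then show "\<exists>N. \<forall>n\<ge>N. root n (real (ball_size A n)) \<le> root n (real (ball_size B n))" by blast
qed

text \<open>If the rate did not grow, \<open>m\<close>-th roots in \<open>ball_size_gain\<close>
  would bound the gain \<open>L\<close> per inserted commutator by \<open>rate F ^ C\<close>, where
  \<open>C\<close> is the length of the commutator word.\<close>

lemma rate_insert_less:
  assumes F: "finite F" and k: "k \<notin> F"
  shows "rate F < rate (insert k F)"
proof (rule ccontr)
  assume "\<not> rate F < rate (insert k F)"
  then have le: "rate (insert k F) \<le> rate F" by simp
  define C where "C = 4 * k + 8"
  \<comment> \<open>Four is an upper bound for every rate, so this \<open>L\<close> exceeds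
    \<open>rate F ^ C\<close>.\<close>
  define L where "L = (4::nat) ^ C + 1"
  define D where "D = 2 * ((2 * L + 1) * (card F + 2) + 1)"
  have pos: "0 < L" "0 < D" by (auto simp: L_def D_def)
  have "(\<lambda>m. root m 2 * root m (real (ball_size (insert k F) ((D + C) * m)))) \<longlonglongrightarrow> 1 * rate (insert k F) ^ (D + C)"
    using pos by (intro tendsto_mult LIMSEQ_root_const ball_size_multiple_LIMSEQ) auto
  moreover have "rate F ^ D * real L \<le> root m 2 * root m (real (ball_size (insert k F) ((D + C) * m)))"
    if m: "1 \<le> m" for m
  proof -
    have "(rate F ^ D * real L) ^ m = rate F ^ (D * m) * real L ^ m"
      by (simp add: power_mult_distrib power_mult)
    also have "\<dots> \<le> real (ball_size F (D * m)) * real L ^ m"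
      using m pos by (intro mult_right_mono rate_pow_le_ball_size) auto
    also have "\<dots> = real (ball_size F (D * m) * L ^ m)" by simp
    also have "\<dots> \<le> real (2 * ball_size (insert k F) ((D + C) * m))"
      using ball_size_gain[OF F k _ pos(1) D_def, of m] m unfolding of_nat_le_iff by (simp add: C_def add.assoc)
    finally have "(rate F ^ D * real L) ^ m \<le> 2 * real (ball_size (insert k F) ((D + C) * m))" by simp
    then have "root m ((rate F ^ D * real L) ^ m) \<le> root m (2 * real (ball_size (insert k F) ((D + C) * m)))"
      using m by (intro real_root_le_mono) auto
    moreover have "0 \<le> rate F ^ D * real L" using rate_ge_1[of F] by simp
    ultimately show ?thesis using m by (simp add: real_root_power_cancel real_root_mult)
  qed
  ultimately have "rate F ^ D * real L \<le> 1 * rate (insert k F) ^ (D + C)"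
    by (intro LIMSEQ_le_const) blast+
  also have "\<dots> \<le> rate F ^ (D + C)" using le rate_ge_1[of "insert k F"] by (simp add: power_mono)
  also have "\<dots> = rate F ^ D * rate F ^ C" by (simp add: power_add)
  finally have "real L \<le> rate F ^ C" using rate_ge_1[of F] by simp
  also have "\<dots> \<le> 4 ^ C"
  proof (rule power_mono)
    have "rate F ^ 1 \<le> real (ball_size F 1)" by (rule rate_pow_le_ball_size) simp
    then show "rate F \<le> 4" using ball_size_1[of F] by simp
  qed (use rate_ge_1[of F] in simp)
  finally show False by (simp add: L_def)
qed

text \<open>Balls are determined by finitely many relators and \<open>rate A ^ n \<le> ball_size A n\<close>, so
  the rate is upper semicontinuous.\<close>

lemma rate_union_less:
  assumes "rate F < u"
  shows "\<exists>N. \<forall>A\<subseteq>{N..}. rate (F \<union> A) < u"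
proof -
  have "\<forall>\<^sub>F n in sequentially. root n (real (ball_size F n)) < u"
    using order_tendstoD(2)[OF rate_LIMSEQ assms] .
  then obtain n where n: "1 \<le> n" "root n (real (ball_size F n)) < u"
    unfolding eventually_sequentially by (metis nat_le_linear)
  have "rate (F \<union> A) < u" if "A \<subseteq> {n..}" for A
  proof -
    have "ball_size (F \<union> A) n = ball_size F n" using that by (intro ball_size_local) auto
    then have "rate (F \<union> A) ^ n \<le> real (ball_size F n)" using rate_pow_le_ball_size[of n "F \<union> A"] n by simp
    then have "root n (rate (F \<union> A) ^ n) \<le> root n (real (ball_size F n))"
      using n by (intro real_root_le_mono) auto
    then show ?thesis using n rate_ge_1[of "F \<union> A"] by (simp add: real_root_power_cancel)
  qed
  then show ?thesis by blast
qed

text \<open>There are only finitely many \<open>F\<close> below \<open>c\<close>, so one threshold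
  serves them all: everything from \<open>N\<close> on together adds less to \<open>F\<close> than
  \<open>c\<close> alone does.\<close>

lemma rate_gap:
  "\<exists>N>c. \<forall>F\<subseteq>{..<c}. \<forall>A\<subseteq>{N..}. rate (F \<union> A) < rate (insert c F)"
proof -
  have "\<exists>N. \<forall>A\<subseteq>{N..}. rate (F \<union> A) < rate (insert c F)" if "F \<subseteq> {..<c}" for F
    using that finite_subset[OF that] by (intro rate_union_less rate_insert_less) auto
  then obtain N where N: "\<And>F A. F \<subseteq> {..<c} \<Longrightarrow> A \<subseteq> {N F..} \<Longrightarrow> rate (F \<union> A) < rate (insert c F)"
    by metis
  define M where "M = Max (insert (Suc c) (N ` Pow {..<c}))"
  have fin: "finite (insert (Suc c) (N ` Pow {..<c}))" by simp
  have "Suc c \<le> M" unfolding M_def by (rule Max_ge[OF fin]) simp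
  then have "c < M" by simp
  moreover have "N F \<le> M" if "F \<subseteq> {..<c}" for F unfolding M_def by (rule Max_ge[OF fin]) (use that in simp)
  then have "rate (F \<union> A) < rate (insert c F)" if "F \<subseteq> {..<c}" "A \<subseteq> {M..}" for F A
    using N[OF that(1), of A] that by (meson atLeast_subset_iff order_trans)
  ultimately show ?thesis by blast
qed

lemma ex_injective_rates: "\<exists>f :: nat set \<Rightarrow> nat set. inj (\<lambda>X. rate (f X))"
proof -
  obtain N where N: "\<And>c. c < N c"
    "\<And>c F A. F \<subseteq> {..<c} \<Longrightarrow> A \<subseteq> {N c..} \<Longrightarrow> rate (F \<union> A) < rate (insert c F)"
    using rate_gap by metis
  \<comment> \<open>Each term is the threshold belonging to the previous one.\<close>
  define k where "k = rec_nat 0 (\<lambda>_. N)"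
  have kS: "k (Suc m) = N (k m)" for m by (simp add: k_def)
  have k: "strict_mono k" unfolding strict_mono_Suc_iff kS using N(1) by blast
  \<comment> \<open>\<open>X\<close> and \<open>Y\<close> agree below \<open>m\<close>. The elements
    of \<open>Y\<close> above \<open>m\<close> are sent past the threshold of \<open>k m\<close>, so
    all of them weigh less than \<open>k m\<close> itself.\<close>
  have less: "rate (k ` Y) < rate (k ` X)"
    if m: "m \<in> X" "m \<notin> Y" and eq: "X \<inter> {..<m} = Y \<inter> {..<m}" for X Y m
  proof -
    let ?F = "k ` (Y \<inter> {..<m})"
    have "k ` (Y \<inter> {m<..}) \<subseteq> {N (k m)..}"
      using strict_mono_less_eq[OF k] by (auto simp flip: kS)
    moreover have "?F \<subseteq> {..<k m}" using strict_mono_less[OF k] by auto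
    ultimately have "rate (?F \<union> k ` (Y \<inter> {m<..})) < rate (insert (k m) ?F)" by (rule N(2)[rotated])
    also have "?F \<union> k ` (Y \<inter> {m<..}) = k ` Y"
    proof -
      have "Y = Y \<inter> {..<m} \<union> Y \<inter> {m<..}" using m(2) by (auto simp: not_less le_less)
      then show ?thesis by (metis image_Un)
    qed
    also have "rate (insert (k m) ?F) \<le> rate (k ` X)"
      using m(1) eq by (intro rate_mono) auto
    finally show ?thesis .
  qed
  have "rate (k ` X) \<noteq> rate (k ` Y)" if "X \<noteq> Y" for X Y
  proof -
    \<comment> \<open>The first difference decides the lexicographic comparison.\<close>
    define m where "m = (LEAST m. (m \<in> X) \<noteq> (m \<in> Y))"
    have ex: "\<exists>m. (m \<in> X) \<noteq> (m \<in> Y)" using that by blast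
    have "(m \<in> X) \<noteq> (m \<in> Y)" unfolding m_def by (rule LeastI_ex[OF ex])
    moreover have "X \<inter> {..<m} = Y \<inter> {..<m}" unfolding m_def by (auto dest: not_less_Least)
    ultimately show ?thesis using less[of m X Y] less[of m Y X] by fastforce
  qed
  then show ?thesis unfolding inj_def by metis
qed

theorem theorem1:
  shows "Omega2 \<approx> (UNIV :: nat set set)"
proof (rule lepoll_antisym)
  have "Omega2 \<lesssim> (UNIV :: real set)" by (simp add: subset_imp_lepoll)
  then show "Omega2 \<lesssim> (UNIV :: nat set set)"
    using nat_sets_eqpoll_reals eqpoll_sym lepoll_trans2 by blast
next
  obtain f :: "nat set \<Rightarrow> nat set" where "inj (\<lambda>X. rate (f X))" using ex_injective_rates by blast
  then show "(UNIV :: nat set set) \<lesssim> Omega2" unfolding lepoll_def using rate_in_Omega2 by blast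
qed

end
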